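(* Let $Z$ be a finite-dimensional Banach space and let $Y$ be a separable (closed linear) subspace of $\ell^\infty(Z)$ containing $c_0(Z)$. Then $c_0(Z)$ is contractively cocomplemented in $Y$.
   Context: $\ell^\infty(Z)$ is the space of all bounded sequences in $Z$ with the sup norm, and $c_0(Z)$ is its subspace of sequences $(z_j)$ with $\|z_j\|\to0$. A closed subspace $X$ of a Banach space $Y$ is contractively cocomplemented in $Y$ if there is a linear projection $P$ from $Y$ onto $X$ with $\|I-P\|\le1$. *)

theory Defs
  imports "HOL-Analysis.Analysis"
begin

text \<open>
  Normed spaces over a scalar field \<open>'k\<close> that may be \<open>real\<close> or \<open>complex\<close>. The library's class
  \<open>real_normed_vector\<close> supplies the norm and the underlying real vector space; \<open>smul\<close> is the
  multiplication by scalars from \<open>'k\<close>. For \<open>'k = real\<close> the last axiom forces \<open>smul = scaleR\<close>.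
  The library types in the sort \<open>{real_normed_field, euclidean_space}\<close> are exactly \<open>real\<close> and
  \<open>complex\<close>, and by Gelfand-Mazur any other such type would be isometrically isomorphic to one of them.
\<close>

locale normed_space_over = vector_space smul
  for smul :: "'k::real_normed_field \<Rightarrow> 'v::real_normed_vector \<Rightarrow> 'v" +
  assumes norm_smul: "norm (smul c x) = norm c * norm x"
    and smul_of_real: "smul (of_real r) x = r *\<^sub>R x"

lemma normed_space_over_scaleR:
  "normed_space_over (scaleR :: real \<Rightarrow> 'v::real_normed_vector \<Rightarrow> 'v)"
  by unfold_locales (auto simp: algebra_simps)

lemma normed_space_over_complex: "normed_space_over ((*) :: complex \<Rightarrow> complex \<Rightarrow> complex)"
  by unfold_locales (auto simp: algebra_simps norm_mult scaleR_conv_of_real)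

text \<open>
  The topology of \<open>nat\<close> is discrete, so \<open>nat \<Rightarrow>\<^sub>C 'z\<close> consists of all bounded sequences in
  \<open>'z\<close>, with the sup norm: it is the space \<open>l\<^sup>\<infinity>('z)\<close>. The library only equips it with
  real scalars; the following is the coordinatewise multiplication by scalars from \<open>'k\<close>.
\<close>

definition linf_smul ::
    "('k \<Rightarrow> 'z \<Rightarrow> 'z) \<Rightarrow> 'k \<Rightarrow> (nat \<Rightarrow>\<^sub>C 'z::real_normed_vector) \<Rightarrow> (nat \<Rightarrow>\<^sub>C 'z)"
  where "linf_smul smul c f = Bcontfun (\<lambda>j. smul c (apply_bcontfun f j))"

definition c0 :: "(nat \<Rightarrow>\<^sub>C 'z::real_normed_vector) set"
  where "c0 = {f. (\<lambda>j. norm (apply_bcontfun f j)) \<longlonglongrightarrow> 0}"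

text \<open>
  Meant for closed linear subspaces \<open>X \<subseteq> Y\<close> of an ambient Banach space with scalar
  multiplication \<open>smul\<close>.
  Only the restriction of \<open>P\<close> to \<open>Y\<close> matters; the last conjunct says \<open>\<parallel>I - P\<parallel> \<le> 1\<close> on \<open>Y\<close>.
\<close>

definition contractively_cocomplemented ::
    "('k \<Rightarrow> 'v::real_normed_vector \<Rightarrow> 'v) \<Rightarrow> 'v set \<Rightarrow> 'v set \<Rightarrow> bool"
  where "contractively_cocomplemented smul X Y \<longleftrightarrow>
    (\<exists>P. (\<forall>x\<in>Y. \<forall>y\<in>Y. P (x + y) = P x + P y) \<and>
         (\<forall>c. \<forall>y\<in>Y. P (smul c y) = smul c (P y)) \<and>
         P ` Y = X \<and> (\<forall>y\<in>Y. P (P y) = P y) \<and>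
         (\<forall>y\<in>Y. norm (y - P y) \<le> norm y))"

lemma apply_linf_smul:
  assumes "normed_space_over smul"
  shows "apply_bcontfun (linf_smul smul c f) j = smul c (apply_bcontfun f j)"
proof -
  interpret normed_space_over smul by fact
  obtain K where K: "\<And>j. norm (apply_bcontfun f j) \<le> K"
    using bounded_apply_bcontfun[of f] by (auto simp: bounded_iff)
  have "norm (smul c (apply_bcontfun f j)) \<le> norm c * K" for j
    by (simp add: norm_smul mult_left_mono K)
  then have "(\<lambda>j. smul c (apply_bcontfun f j)) \<in> bcontfun"
    by (auto simp: bcontfun_def bounded_iff)
  then show ?thesis
    by (simp add: linf_smul_def Bcontfun_inverse)
qed

lemma normed_space_over_linf_smul:
  assumes "normed_space_over smul"
  shows "normed_space_over (linf_smul smul)"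
proof -
  interpret normed_space_over smul by fact
  note ap = apply_linf_smul[OF assms]
  have le: "norm (linf_smul smul c f) \<le> norm c * norm f" for c f
    by (rule norm_bound) (simp add: ap norm_smul mult_left_mono norm_bounded)
  have inv: "linf_smul smul (inverse c) (linf_smul smul c f) = f" if "c \<noteq> 0" for c f
    by (rule bcontfun_eqI) (use that in \<open>simp add: ap\<close>)
  have ge: "norm c * norm f \<le> norm (linf_smul smul c f)" for c f
  proof (cases "c = 0")
    case False
    then have "norm f \<le> inverse (norm c) * norm (linf_smul smul c f)"
      using le[of "inverse c" "linf_smul smul c f"] by (simp add: inv norm_inverse)
    then show ?thesis
      using False by (simp add: field_simps)
  qed simp
  show ?thesis
    by unfold_locales
      (auto intro!: bcontfun_eqI antisym le ge
        simp: ap scale_right_distrib scale_left_distrib smul_of_real)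
qed

end

theory Submission
  imports Defs
begin

text \<open>
  This is Veech's proof of Sobczyk's theorem, with the coordinate functionals of \<open>c\<^sub>0\<close> replaced by
  the coordinate maps \<open>T\<^sub>j y = y\<^sub>j\<close>, which are linear contractions into the finite-dimensional space
  \<open>Z\<close>. Suppose that contractions \<open>S\<^sub>j\<close> into \<open>Z\<close> vanish on \<open>c\<^sub>0(Z)\<close> and satisfy
  \<open>T\<^sub>j y - S\<^sub>j y \<longlonglongrightarrow> 0\<close> for all \<open>y\<close> in \<open>Y\<close>. Then \<open>P y = (T\<^sub>j y - S\<^sub>j y)\<^sub>j\<close> lies in \<open>c\<^sub>0(Z)\<close>, \<open>P\<close> is
  the identity on \<open>c\<^sub>0(Z)\<close>, and \<open>y - P y = (S\<^sub>j y)\<^sub>j\<close> has norm at most \<open>\<parallel>y\<parallel>\<close>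
  (\<open>contractively_cocomplemented_c0I\<close>).

  The \<open>S\<^sub>j\<close> come from compactness. Balls of \<open>Z\<close> are compact, so by Tychonoff the maps \<open>T\<^sub>j\<close> live in
  a set that is compact for pointwise convergence, and every cluster point of the sequence
  \<open>T\<^sub>j\<close> is a linear contraction. It vanishes on \<open>c\<^sub>0(Z)\<close>, because \<open>T\<^sub>j x \<longlonglongrightarrow> 0\<close> for \<open>x\<close> in \<open>c\<^sub>0(Z)\<close>
  (\<open>cluster_point_c0_annihilating\<close>). Hence on any finite set the \<open>T\<^sub>j\<close> are eventually as close as
  desired to contractions vanishing on \<open>c\<^sub>0(Z)\<close>. Letting the finite set exhaust a countable dense
  subset of \<open>Y\<close> slowly as \<open>j\<close> grows gives \<open>T\<^sub>j y - S\<^sub>j y \<longlonglongrightarrow> 0\<close> on this subset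
  (\<open>asymptotic_c0_annihilating_sequence\<close>), and the bound on the norms extends this to \<open>Y\<close>.
\<close>

section \<open>Compactness of balls in finite-dimensional spaces\<close>

lemma (in normed_space_over) bounded_linear_smul_right: "bounded_linear (smul c)"
proof (rule bounded_linear_intro[where K = "norm c"])
  show "smul c (r *\<^sub>R x) = r *\<^sub>R smul c x" for r x
    by (simp flip: smul_of_real add: scale_left_commute)
qed (simp_all add: scale_right_distrib norm_smul)

lemma (in normed_space_over) continuous_on_add_smul:
  "continuous_on UNIV (\<lambda>(a, c). a + smul c b)"
proof -
  have "bounded_linear (\<lambda>c. smul c b)"
  proof (rule bounded_linear_intro[where K = "norm b"])
    show "smul (r *\<^sub>R c) b = r *\<^sub>R smul c b" for r c
      by (simp flip: smul_of_real scale_scale add: scaleR_conv_of_real)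
  qed (simp_all add: scale_left_distrib norm_smul)
  from bounded_linear.continuous_on[OF this continuous_on_snd[OF continuous_on_id]]
  show ?thesis
    unfolding case_prod_unfold by (intro continuous_on_add continuous_on_fst continuous_on_id)
qed

lemma closed_if_bounded_parts_in_compact:
  fixes A :: "'a::real_normed_vector set"
  assumes "\<And>R. \<exists>C. compact C \<and> C \<subseteq> A \<and> A \<inter> cball 0 R \<subseteq> C"
  shows "closed A"
  unfolding closed_sequential_limits
proof (intro allI impI)
  fix x l assume x: "(\<forall>n. x n \<in> A) \<and> x \<longlonglongrightarrow> l"
  obtain R where R: "\<And>n. norm (x n) \<le> R"
    using convergent_imp_Bseq[of x] x by (auto simp: convergent_def Bseq_def)
  obtain C where C: "compact C" "C \<subseteq> A" "A \<inter> cball 0 R \<subseteq> C"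
    using assms by blast
  have "x n \<in> C" for n
    using x R C(3) by auto
  then have "l \<in> C"
    using closed_sequentially[OF compact_imp_closed[OF C(1)]] x by blast
  with C(2) show "l \<in> A" ..
qed

text \<open>
  Induction on the spanning set. If the new vector \<open>b\<close> is not in \<open>span B\<close>, it has a positive
  distance \<open>d\<close> from it, since \<open>span B\<close> is closed by the induction hypothesis. So in a bounded
  vector \<open>a + c b\<close> the coefficient \<open>c\<close>, and with it \<open>a\<close>, is bounded, and such vectors lie in the
  image of a compact product. The compact set is required to lie inside the span because this is
  what makes the span closed.
\<close>

lemma span_bounded_part_in_compact:
  fixes smul :: "'k::{real_normed_field, heine_borel} \<Rightarrow> 'z::real_normed_vector \<Rightarrow> 'z"
  assumes "normed_space_over smul" and "finite B"
  shows "\<exists>C. compact C \<and> C \<subseteq> module.span smul B \<and> module.span smul B \<inter> cball 0 R \<subseteq> C"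
proof -
  interpret normed_space_over smul by fact
  from \<open>finite B\<close> show ?thesis
  proof (induction B arbitrary: R)
    case empty
    show ?case
      by (rule exI[of _ "{0}"]) auto
  next
    case (insert b B)
    show ?case
    proof (cases "b \<in> span B")
      case True
      then show ?thesis
        using insert.IH by (simp add: span_redundant)
    next
      case False
      define d where "d = infdist b (span B)"
      have "closed (span B)"
        using insert.IH by (rule closed_if_bounded_parts_in_compact)
      then have "d > 0"
        unfolding d_def using False span_zero by (intro infdist_pos_not_in_closed) auto
      \<comment> \<open>\<open>a + c b\<close> is \<open>c\<close> times the difference of \<open>b\<close> and the vector \<open>- a / c\<close> of \<open>span B\<close>\<close>
      have coeff: "norm c * d \<le> norm (a + smul c b)" if "a \<in> span B" for a c
      proof (cases "c = 0")
        case False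
        have "d \<le> dist b (smul (- inverse c) a)"
          unfolding d_def by (intro infdist_le span_scale that)
        also have "\<dots> = norm (smul (inverse c) (a + smul c b))"
          using False by (simp add: dist_norm scale_right_distrib add.commute)
        also have "\<dots> = norm (a + smul c b) / norm c"
          by (simp add: norm_smul norm_inverse divide_inverse mult.commute)
        finally show ?thesis
          using False by (simp add: pos_le_divide_eq mult.commute)
      qed simp
      define r where "r = R / d"
      obtain C where C: "compact C" "C \<subseteq> span B" "span B \<inter> cball 0 (R + r * norm b) \<subseteq> C"
        using insert.IH by blast
      let ?C = "(\<lambda>(a, c). a + smul c b) ` (C \<times> cball 0 r)"
      have "compact ?C"
        using C(1) continuous_on_subset[OF continuous_on_add_smul]
        by (intro compact_continuous_image compact_Times) auto
      moreover have "?C \<subseteq> span (insert b B)"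
      proof clarify
        fix a c assume "a \<in> C"
        then have "a \<in> span (insert b B)"
          using C(2) span_mono[OF subset_insertI] by blast
        then show "a + smul c b \<in> span (insert b B)"
          by (rule span_add[OF _ span_scale[OF span_base[OF insertI1]]])
      qed
      moreover have "span (insert b B) \<inter> cball 0 R \<subseteq> ?C"
      proof
        fix x assume x: "x \<in> span (insert b B) \<inter> cball 0 R"
        then obtain c where a: "x - smul c b \<in> span B"
          by (auto simp: span_insert)
        have "norm c * d \<le> R"
          using coeff[OF a, of c] x by simp
        then have c: "norm c \<le> r"
          using \<open>d > 0\<close> by (simp add: r_def field_simps)
        have "norm (x - smul c b) \<le> norm x + norm c * norm b"
          using norm_triangle_ineq4[of x "smul c b"] by (simp add: norm_smul)
        also have "\<dots> \<le> R + r * norm b"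
          using x c by (intro add_mono mult_right_mono) auto
        finally have "x - smul c b \<in> C"
          using a C(3) by auto
        then show "x \<in> ?C"
          using c by (intro image_eqI[of _ _ "(x - smul c b, c)"]) auto
      qed
      ultimately show ?thesis by blast
    qed
  qed
qed

lemma finite_dimensional_compact_cball:
  fixes smul :: "'k::{real_normed_field, heine_borel} \<Rightarrow> 'z::real_normed_vector \<Rightarrow> 'z"
  assumes "normed_space_over smul" and "finite_dimensional_vector_space smul B"
  shows "compact (cball (0::'z) R)"
proof -
  interpret finite_dimensional_vector_space smul B by fact
  obtain C :: "'z set" where C: "compact C" "span B \<inter> cball 0 R \<subseteq> C"
    using span_bounded_part_in_compact[OF assms(1) finite_Basis] by blast
  then have "C \<inter> cball 0 R = cball 0 R"
    unfolding span_Basis by blast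
  with compact_Int_closed[OF C(1), of "cball 0 R"] show ?thesis
    by simp
qed

section \<open>Limit points of the coordinate maps\<close>

text \<open>
  These contractions live on all of \<open>l\<^sup>\<infinity>(Z)\<close>, as the coordinate maps do, so that linearity can
  be stated without restriction to a subspace.
\<close>

definition c0_annihilating ::
    "('k \<Rightarrow> 'z \<Rightarrow> 'z) \<Rightarrow> ((nat \<Rightarrow>\<^sub>C 'z::real_normed_vector) \<Rightarrow> 'z) set"
  where "c0_annihilating smul =
    {S. (\<forall>x y. S (x + y) = S x + S y) \<and> (\<forall>c x. S (linf_smul smul c x) = smul c (S x)) \<and>
        (\<forall>x. norm (S x) \<le> norm x) \<and> (\<forall>x\<in>c0. S x = 0)}"

lemma compact_functions_into_compacts:
  fixes A :: "'i \<Rightarrow> 'a::topological_space set"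
  assumes "\<And>i. compact (A i)"
  shows "compact {f. \<forall>i. f i \<in> A i}"
proof -
  have "compactin (product_topology (\<lambda>_. euclidean) UNIV) (PiE UNIV A)"
    using assms by (simp add: compactin_PiE)
  moreover have "PiE UNIV A = {f. \<forall>i. f i \<in> A i}"
    by auto
  ultimately show ?thesis
    by (simp add: euclidean_product_topology)
qed

text \<open>
  The filter \<open>J\<close> plays the role of a subsequence. Since pointwise convergence on \<open>l\<^sup>\<infinity>(Z)\<close> need not be
  metrizable, compactness provides a cluster point \<open>S\<close> rather than a convergent subsequence. The
  infimum of \<open>nhds S\<close> with the image of \<open>J\<close> is then a proper filter that converges to \<open>S\<close> and to
  which every property shared by all coordinate maps belongs, so that \<open>S\<close> inherits linearity by
  uniqueness of limits.
\<close>

lemma cluster_point_c0_annihilating: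
  fixes smul :: "'k::real_normed_field \<Rightarrow> 'z::real_normed_vector \<Rightarrow> 'z"
  assumes smul: "normed_space_over smul"
    and compact: "\<And>R. compact (cball (0::'z) R)"
    and J: "J \<noteq> bot" "J \<le> sequentially"
  shows "\<exists>S \<in> c0_annihilating smul.
    inf (nhds S) (filtermap (\<lambda>j x. apply_bcontfun x j) J) \<noteq> bot"
proof -
  interpret normed_space_over smul by fact
  let ?T = "\<lambda>j (x::nat \<Rightarrow>\<^sub>C 'z). apply_bcontfun x j"
  let ?F = "filtermap ?T J"
  let ?U = "{f. \<forall>x. f x \<in> cball (0::'z) (norm (x::nat \<Rightarrow>\<^sub>C 'z))}"
  have "compact ?U"
    by (intro compact_functions_into_compacts compact)
  moreover have "eventually (\<lambda>f. f \<in> ?U) ?F"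
    by (simp add: eventually_filtermap norm_bounded)
  moreover have "?F \<noteq> bot"
    using J(1) by (simp add: filtermap_bot_iff)
  ultimately obtain S where S: "S \<in> ?U" "inf (nhds S) ?F \<noteq> bot"
    unfolding compact_filter by blast
  define G where "G = inf (nhds S) ?F"
  have lim: "((\<lambda>f. f x) \<longlongrightarrow> S x) G" for x
  proof -
    have "((\<lambda>f. f x) \<longlongrightarrow> S x) (nhds S)"
    proof (rule topological_tendstoI)
      fix V :: "'z set" assume V: "open V" "S x \<in> V"
      have "open ((\<lambda>f. f x) -` V)"
        by (rule open_vimage[OF V(1) continuous_on_product_coordinates])
      then show "\<forall>\<^sub>F f in nhds S. f x \<in> V"
        using V(2) eventually_nhds_in_open[of "(\<lambda>f. f x) -` V" S] by simp
    qed
    then show ?thesis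
      unfolding G_def by (rule tendsto_mono[rotated]) simp
  qed
  have ev: "eventually Q G" if "\<And>j. Q (?T j)" for Q
    unfolding G_def using that
    by (intro filter_leD[OF inf_le2]) (simp add: eventually_filtermap)
  have G: "G \<noteq> bot"
    using S(2) by (simp add: G_def)
  have "S (x + y) = S x + S y" for x y
  proof (rule tendsto_unique[OF G lim])
    show "((\<lambda>f. f (x + y)) \<longlongrightarrow> S x + S y) G"
      by (rule Lim_transform_eventually[OF tendsto_add[OF lim lim]]) (rule ev, simp)
  qed
  moreover have "S (linf_smul smul c x) = smul c (S x)" for c x
  proof (rule tendsto_unique[OF G lim])
    show "((\<lambda>f. f (linf_smul smul c x)) \<longlongrightarrow> smul c (S x)) G"
      by (rule Lim_transform_eventually[OF bounded_linear.tendsto[OF bounded_linear_smul_right lim]])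
        (rule ev, simp add: apply_linf_smul[OF smul])
  qed
  moreover have "norm (S x) \<le> norm x" for x
    using S(1) by simp
  moreover have "S x = 0" if "x \<in> c0" for x
  proof (rule tendsto_unique[OF G lim])
    have "(\<lambda>j. apply_bcontfun x j) \<longlonglongrightarrow> 0"
      using that by (simp add: c0_def tendsto_norm_zero_iff)
    then have "((\<lambda>j. apply_bcontfun x j) \<longlongrightarrow> 0) J"
      by (rule tendsto_mono[OF J(2)])
    then have "((\<lambda>f. f x) \<longlongrightarrow> 0) ?F"
      by (simp add: filterlim_filtermap)
    then show "((\<lambda>f. f x) \<longlongrightarrow> 0) G"
      unfolding G_def by (rule tendsto_mono[rotated]) simp
  qed
  ultimately have "S \<in> c0_annihilating smul"
    by (simp add: c0_annihilating_def)
  with S(2) show ?thesis ..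
qed

text \<open>
  Otherwise a cluster point along the indices that violate the claim would itself be close to a
  coordinate map with such an index.
\<close>

lemma eventually_near_c0_annihilating:
  fixes smul :: "'k::real_normed_field \<Rightarrow> 'z::real_normed_vector \<Rightarrow> 'z"
  assumes smul: "normed_space_over smul"
    and compact: "\<And>R. compact (cball (0::'z) R)"
    and "finite D" "e > 0"
  shows "\<forall>\<^sub>F j in sequentially. \<exists>S \<in> c0_annihilating smul. \<forall>x\<in>D. dist (apply_bcontfun x j) (S x) < e"
    (is "eventually ?near _")
proof (rule ccontr)
  assume not_ev: "\<not> eventually ?near sequentially"
  define J where "J = inf sequentially (principal {j. \<not> ?near j})"
  have "J \<noteq> bot"
    using not_ev by (auto simp: J_def trivial_limit_def eventually_inf_principal)
  moreover have "J \<le> sequentially"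
    by (simp add: J_def)
  ultimately obtain S where S: "S \<in> c0_annihilating smul"
    and cl: "inf (nhds S) (filtermap (\<lambda>j x. apply_bcontfun x j) J) \<noteq> bot"
    using cluster_point_c0_annihilating[OF smul compact] by blast
  have "open (\<Inter>x\<in>D. (\<lambda>f. f x) -` ball (S x) e)"
    using \<open>finite D\<close> by (intro open_INT ballI open_vimage) auto
  then have 1: "\<forall>\<^sub>F f in nhds S. f \<in> (\<Inter>x\<in>D. (\<lambda>f. f x) -` ball (S x) e)"
    using \<open>e > 0\<close> by (intro eventually_nhds_in_open) auto
  have "\<forall>\<^sub>F j in J. \<not> ?near j"
    by (simp add: J_def eventually_inf_principal)
  then have "\<forall>\<^sub>F f in filtermap (\<lambda>j x. apply_bcontfun x j) J. \<not> (\<forall>x\<in>D. dist (f x) (S x) < e)"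
    unfolding eventually_filtermap by eventually_elim (use S in blast)
  with 1 have "\<forall>\<^sub>F f in inf (nhds S) (filtermap (\<lambda>j x. apply_bcontfun x j) J). False"
    unfolding eventually_inf
    by (intro exI conjI) (assumption, assumption, auto simp: dist_commute)
  with cl show False
    by (simp add: trivial_limit_def)
qed

section \<open>Asymptotic approximation and the projection\<close>

text \<open>
  A diagonal choice: at time \<open>j\<close> use the highest level up to \<open>j\<close> that is attainable. The cap at
  \<open>j\<close> makes the maximum exist, and level \<open>0\<close> is there to ensure that there is a candidate.
\<close>

lemma eventually_all_levels_selection:
  fixes P :: "nat \<Rightarrow> nat \<Rightarrow> 'a \<Rightarrow> bool"
  assumes zero: "\<And>j. \<exists>s. P 0 j s"
    and ev: "\<And>m. \<forall>\<^sub>F j in sequentially. \<exists>s. P m j s"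
  obtains s k where "\<And>j. P (k j) j (s j)" "filterlim k at_top sequentially"
proof -
  define k where "k j = (GREATEST m. m \<le> j \<and> (\<exists>s. P m j s))" for j
  have "k j \<le> j \<and> (\<exists>s. P (k j) j s)" for j
    unfolding k_def by (rule GreatestI_nat[of _ 0 j]) (use zero in auto)
  then obtain s where "\<And>j. P (k j) j (s j)"
    by metis
  moreover have "filterlim k at_top sequentially"
    unfolding filterlim_at_top
  proof
    fix m
    from ev[of m] eventually_ge_at_top[of m] show "\<forall>\<^sub>F j in sequentially. m \<le> k j"
    proof eventually_elim
      case (elim j)
      then show ?case
        unfolding k_def by (intro Greatest_le_nat[of _ m j]) auto
    qed
  qed
  ultimately show ?thesis
    by (rule that)
qed

lemma asymptotic_c0_annihilating_sequence:
  fixes smul :: "'k::real_normed_field \<Rightarrow> 'z::real_normed_vector \<Rightarrow> 'z"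
  assumes smul: "normed_space_over smul"
    and compact: "\<And>R. compact (cball (0::'z) R)"
    and "countable D"
  obtains S where "\<And>j. S j \<in> c0_annihilating smul"
    and "\<And>x. x \<in> D \<Longrightarrow> (\<lambda>j. dist (apply_bcontfun x j) (S j x)) \<longlonglongrightarrow> 0"
proof -
  interpret normed_space_over smul by fact
  define d where "d = from_nat_into D"
  define P where "P m j S \<longleftrightarrow> S \<in> c0_annihilating smul \<and>
      (\<forall>n<m. dist (apply_bcontfun (d n) j) (S (d n)) < inverse (real (Suc m)))" for m j S
  \<comment> \<open>at level \<open>0\<close> there is no condition on distances, so the zero map serves\<close>
  have "(\<lambda>_. 0) \<in> c0_annihilating smul"
    by (simp add: c0_annihilating_def)
  then have "\<exists>S. P 0 j S" for j
    by (auto simp: P_def)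
  moreover have "\<forall>\<^sub>F j in sequentially. \<exists>S. P m j S" for m
    using eventually_near_c0_annihilating[OF smul compact, of "d ` {..<m}" "inverse (real (Suc m))"]
    by (auto simp: P_def elim!: eventually_mono)
  ultimately obtain S k where S: "\<And>j. P (k j) j (S j)" and k: "filterlim k at_top sequentially"
    using eventually_all_levels_selection[of P] by blast
  have "(\<lambda>j. dist (apply_bcontfun x j) (S j x)) \<longlonglongrightarrow> 0" if "x \<in> D" for x
  proof (rule tendsto_sandwich[OF _ _ tendsto_const])
    obtain n where n: "x = d n"
      using \<open>x \<in> D\<close> from_nat_into_surj[OF \<open>countable D\<close>] unfolding d_def by metis
    have "\<forall>\<^sub>F j in sequentially. n < k j"
      using k[unfolded filterlim_at_top, rule_format, of "Suc n"]
      by (simp add: Suc_le_eq)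
    then show "\<forall>\<^sub>F j in sequentially. dist (apply_bcontfun x j) (S j x) \<le> inverse (real (Suc (k j)))"
      using S by (auto simp: P_def n elim!: eventually_mono intro!: less_imp_le)
    show "(\<lambda>j. inverse (real (Suc (k j)))) \<longlonglongrightarrow> 0"
      by (rule filterlim_compose[OF LIMSEQ_inverse_real_of_nat k])
  qed simp
  with S show ?thesis
    by (intro that[of S]) (auto simp: P_def)
qed

text \<open>
  All maps involved are contractions, so moving from \<open>y\<close> to a nearby point of \<open>D\<close> changes the
  values of both by little, uniformly in \<open>j\<close>: an \<open>\<epsilon>/3\<close> argument.
\<close>

lemma asymptotic_on_closure:
  assumes S: "\<And>j. S j \<in> c0_annihilating smul"
    and lim: "\<And>x. x \<in> D \<Longrightarrow> (\<lambda>j. dist (apply_bcontfun x j) (S j x)) \<longlonglongrightarrow> 0"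
    and "y \<in> closure D"
  shows "(\<lambda>j. dist (apply_bcontfun y j) (S j y)) \<longlonglongrightarrow> 0"
proof (rule tendstoI)
  fix e :: real assume "e > 0"
  then obtain x where x: "x \<in> D" "dist x y < e / 3"
    using \<open>y \<in> closure D\<close> unfolding closure_approachable by (metis zero_less_divide_iff zero_less_numeral)
  have "\<forall>\<^sub>F j in sequentially. dist (apply_bcontfun x j) (S j x) < e / 3"
    using order_tendstoD(2)[OF lim[OF x(1)], of "e / 3"] \<open>e > 0\<close> by simp
  then show "\<forall>\<^sub>F j in sequentially. dist (dist (apply_bcontfun y j) (S j y)) 0 < e"
  proof eventually_elim
    case (elim j)
    have "S j x = S j (x - y) + S j y"
      using S[of j] by (simp add: c0_annihilating_def flip: add.assoc)
        (metis diff_add_cancel)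
    moreover have "norm (S j (x - y)) \<le> norm (x - y)"
      using S[of j] by (simp add: c0_annihilating_def)
    ultimately have "dist (S j x) (S j y) \<le> dist x y"
      by (simp add: dist_norm)
    moreover have "dist (apply_bcontfun x j) (apply_bcontfun y j) \<le> dist x y"
      by (rule dist_bounded)
    ultimately show ?case
      using elim x(2) dist_triangle[of "apply_bcontfun y j" "S j y" "apply_bcontfun x j"]
        dist_triangle[of "apply_bcontfun x j" "S j y" "S j x"]
      by (simp add: dist_commute)
  qed
qed

lemma contractively_cocomplemented_c0I:
  fixes smul :: "'k::real_normed_field \<Rightarrow> 'z::real_normed_vector \<Rightarrow> 'z"
    and Y :: "(nat \<Rightarrow>\<^sub>C 'z) set"
  assumes smul: "normed_space_over smul"
    and S: "\<And>j. S j \<in> c0_annihilating smul"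
    and lim: "\<And>y. y \<in> Y \<Longrightarrow> (\<lambda>j. dist (apply_bcontfun y j) (S j y)) \<longlonglongrightarrow> 0"
    and "c0 \<subseteq> Y"
  shows "contractively_cocomplemented (linf_smul smul) c0 Y"
proof -
  interpret normed_space_over smul by fact
  interpret linf: normed_space_over "linf_smul smul"
    by (rule normed_space_over_linf_smul[OF smul])
  have S_add: "S j (x + y) = S j x + S j y"
    and S_smul: "S j (linf_smul smul c x) = smul c (S j x)"
    and S_norm: "norm (S j x) \<le> norm x" for j x y c
    using S[of j] by (simp_all add: c0_annihilating_def)
  have S_c0: "S j x = 0" if "x \<in> c0" for j x
    using S[of j] that by (simp add: c0_annihilating_def)
  define L where "L y = Bcontfun (\<lambda>j. S j y)" for y
  have L: "apply_bcontfun (L y) j = S j y" for y j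
  proof -
    have "(\<lambda>j. S j y) \<in> bcontfun"
      using S_norm by (intro bcontfun_normI) auto
    then show ?thesis
      by (simp add: L_def Bcontfun_inverse)
  qed
  define P where "P y = y - L y" for y
  have P_c0: "P y = y" if "y \<in> c0" for y
    by (rule bcontfun_eqI) (simp add: P_def L S_c0 that)
  have P_in: "P y \<in> c0" if "y \<in> Y" for y
    using lim[OF that] by (simp add: c0_def P_def L dist_norm)
  show ?thesis
    unfolding contractively_cocomplemented_def
  proof (intro exI[of _ P] conjI ballI allI)
    show "P (x + y) = P x + P y" for x y
      by (rule bcontfun_eqI) (simp add: P_def L S_add)
    show "P (linf_smul smul c y) = linf_smul smul c (P y)" for c y
      by (rule bcontfun_eqI)
        (simp add: P_def L S_smul apply_linf_smul[OF smul] scale_right_diff_distrib)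
    show "P ` Y = c0"
    proof (intro antisym subsetI)
      fix x :: "nat \<Rightarrow>\<^sub>C 'z" assume "x \<in> c0"
      then show "x \<in> P ` Y"
        using \<open>c0 \<subseteq> Y\<close> by (intro image_eqI[of _ _ x]) (auto simp: P_c0)
    qed (auto intro: P_in)
    show "P (P y) = P y" if "y \<in> Y" for y
      by (rule P_c0[OF P_in[OF that]])
    show "norm (y - P y) \<le> norm y" for y
      by (rule norm_bound) (simp add: P_def L S_norm)
  qed
qed

theorem corollary1p12:
  fixes smul :: "'k::{real_normed_field, euclidean_space} \<Rightarrow> 'z::banach \<Rightarrow> 'z"
    and Y :: "(nat \<Rightarrow>\<^sub>C 'z) set"
  assumes "normed_space_over smul"
    and "\<exists>B. finite_dimensional_vector_space smul B"
    and "module.subspace (linf_smul smul) Y"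
    and "closed Y"
    and "separable_space (top_of_set Y)"
    and "c0 \<subseteq> Y"
  shows "contractively_cocomplemented (linf_smul smul) c0 Y"
proof -
  have compact: "compact (cball (0::'z) R)" for R
    using assms(2) finite_dimensional_compact_cball[OF assms(1)] by blast
  obtain D where D: "countable D" "D \<subseteq> Y" "(top_of_set Y) closure_of D = Y"
    using assms(5) by (auto simp: separable_space_def)
  then have dense: "Y \<subseteq> closure D"
    using closure_mono[of "Y \<inter> D" D] by (auto simp: closure_of_subtopology)
  obtain S where S: "\<And>j. S j \<in> c0_annihilating smul"
    and "\<And>x. x \<in> D \<Longrightarrow> (\<lambda>j. dist (apply_bcontfun x j) (S j x)) \<longlonglongrightarrow> 0"
    using asymptotic_c0_annihilating_sequence[OF assms(1) compact D(1)] by blast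
  then have "(\<lambda>j. dist (apply_bcontfun y j) (S j y)) \<longlonglongrightarrow> 0" if "y \<in> Y" for y
    using asymptotic_on_closure[where D = D] dense that by blast
  with assms(1) S show ?thesis
    using assms(6) by (rule contractively_cocomplemented_c0I)
qed

end
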